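(* Let $p\ge 3$ be an integer. Let $P_m^p(t)=\mathbb E_\lambda[t^{\phi^{(m)}(x)}]$ be the polynomials defined in the context, let $D_m=\deg P_m^p$, and let $\{\hat S_j\}_{j\ge0}$ be the substitution sequence defined in the context. Then for every $m\ge 0$, $$D_m=\sum_{j=0}^{m-1}\hat S_j .$$
   Context: Polynomials. Let $p\ge 3$ be an integer (not necessarily prime). $\Gamma=\{x=(x_0,x_1,x_2,\ldots): x_k\in\{0,1,\ldots,p-1\}\}$ is the compact group of $p$-adic integers (addition with carry to the right), and $\lambda$ is its Haar probability measure; under $\lambda$ the coordinates are i.i.d. uniform on $\{0,\ldots,p-1\}$. $\Gamma'=\Gamma\setminus\{(p-1,p-1,\ldots)\}$. Let $S:x\mapsto x+1$ with $1=(1,0,0,\ldots)$. For $x\in\Gamma'$, $\phi(x)$ is the first coordinate of $x$ different from $p-1$. Put $\phi^{(0)}=0$ and $\phi^{(m)}(x)=\phi(x)+\phi(Sx)+\cdots+\phi(S^{m-1}x)$ for $m\ge1$ (defined $\lambda$-a.e.). Put $P_m^p(t)=\mathbb E_\lambda[t^{\phi^{(m)}(x)}]=\sum_j \lambda(\phi^{(m)}=j)\,t^j$, a polynomial in $t$. Substitution sequence. Consider the substitution replacing each $q\in\{0,\ldots,p-2\}$ by the word of length $p$ that lists $p-2,p-3,\ldots,1,0$ in decreasing order with $q$ taken twice in a row (e.g. $0\mapsto p-2,\ldots,1,0,0$ and $p-2\mapsto p-2,p-2,p-3,\ldots,0$). Let $\{\hat S^{(0)}_j\}_{0\le j\le p-1}$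 be the word $p-2,p-2,p-3,\ldots,1,0$, and let $\{\hat S^{(l+1)}_j\}_{0\le j<p^{l+2}}$ be obtained from $\{\hat S^{(l)}_j\}_{0\le j<p^{l+1}}$ by applying the substitution to every entry. Each $\{\hat S^{(l)}_j\}$ is a prefix of $\{\hat S^{(l+1)}_j\}$, and $\{\hat S_j\}_{j\ge0}$ is the infinite sequence having all of them as prefixes. *)

theory Defs
  imports "HOL-Probability.Probability" "HOL-Computational_Algebra.Polynomial"
begin

section \<open>The group of p-adic integers and its Haar measure\<close>

text \<open>A p-adic integer is its digit sequence \<^term>\<open>x :: nat \<Rightarrow> nat\<close>; the measure below is the product
  of the uniform distributions on the digits. It is a probability measure (\<open>prob_space_Haar\<close>) that is
  invariant under every translation of the group (\<open>Haar_translation_invariant\<close>). Its \<open>\<sigma>\<close>-algebra,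
  generated by the coordinates, is the Borel \<open>\<sigma>\<close>-algebra of the product topology.\<close>

definition Haar :: "nat \<Rightarrow> (nat \<Rightarrow> nat) measure" where
  "Haar p = PiM UNIV (\<lambda>_. uniform_count_measure {..<p})"

definition Zp :: "nat \<Rightarrow> (nat \<Rightarrow> nat) set" where
  "Zp p = {x. \<forall>k. x k < p}"

text \<open>\<open>carry p x y k\<close> is the carry entering position \<open>k\<close> when adding \<open>x\<close> and \<open>y\<close>.\<close>

fun carry :: "nat \<Rightarrow> (nat \<Rightarrow> nat) \<Rightarrow> (nat \<Rightarrow> nat) \<Rightarrow> nat \<Rightarrow> nat" where
  "carry p x y 0 = 0"
| "carry p x y (Suc k) = (x k + y k + carry p x y k) div p"

definition padd :: "nat \<Rightarrow> (nat \<Rightarrow> nat) \<Rightarrow> (nat \<Rightarrow> nat) \<Rightarrow> (nat \<Rightarrow> nat)" where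
  "padd p x y = (\<lambda>k. (x k + y k + carry p x y k) mod p)"

definition pone :: "nat \<Rightarrow> nat" where
  "pone = (\<lambda>k. if k = 0 then 1 else 0)"

definition padic_succ :: "nat \<Rightarrow> (nat \<Rightarrow> nat) \<Rightarrow> (nat \<Rightarrow> nat)" where
  "padic_succ p x = padd p x pone"

section \<open>The cocycle and its generating polynomials\<close>

text \<open>At the excluded point \<open>(p-1,p-1,\<dots>)\<close> the value of \<open>phi\<close> is \<open>p-1\<close>; the points whose orbit
  meets it form a null set, so this convention does not affect the polynomials \<open>Ppoly\<close> below.\<close>

definition phi :: "nat \<Rightarrow> (nat \<Rightarrow> nat) \<Rightarrow> nat" where
  "phi p x = x (LEAST k. x k \<noteq> p - 1)"

definition phi_sum :: "nat \<Rightarrow> nat \<Rightarrow> (nat \<Rightarrow> nat) \<Rightarrow> nat" where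
  "phi_sum p m x = (\<Sum>i<m. phi p ((padic_succ p ^^ i) x))"

text \<open>The index set is finite (\<open>phi_sum_le\<close>), and \<open>poly (Ppoly p m) t\<close> is the expectation of
  \<open>t ^ phi_sum p m x\<close> (\<open>poly_Ppoly\<close>).\<close>

definition Ppoly :: "nat \<Rightarrow> nat \<Rightarrow> real poly" where
  "Ppoly p m = (\<Sum>j\<in>phi_sum p m ` Zp p. monom (measure (Haar p) {x \<in> Zp p. phi_sum p m x = j}) j)"

section \<open>The substitution sequence\<close>

definition subst_word :: "nat \<Rightarrow> nat \<Rightarrow> nat list" where
  "subst_word p q = concat (map (\<lambda>r. if r = q then [r, r] else [r]) (rev [0..<p - 1]))"

fun Shat_word :: "nat \<Rightarrow> nat \<Rightarrow> nat list" where
  "Shat_word p 0 = (p - 2) # rev [0..<p - 1]"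
| "Shat_word p (Suc l) = concat (map (subst_word p) (Shat_word p l))"

text \<open>The word of level \<open>j\<close> has length \<open>p ^ (j + 1) > j\<close>; by \<open>Shat_prefix\<close> the resulting infinite
  sequence has all the words as prefixes.\<close>

definition Shat :: "nat \<Rightarrow> nat \<Rightarrow> nat" where
  "Shat p j = Shat_word p j ! j"

section \<open>Well-definedness\<close>

lemma length_subst_word: "q < p - 1 \<Longrightarrow> length (subst_word p q) = p"
proof -
  assume q: "q < p - 1"
  have "length (subst_word p q) = (\<Sum>r<p - 1. if r = q then 2 else 1)"
    unfolding subst_word_def
    by (simp add: length_concat o_def if_distrib rev_map[symmetric] sum_list_rev
        interv_sum_list_conv_sum_set_nat lessThan_atLeast0 numeral_2_eq_2 cong: if_cong)
  also have "\<dots> = (\<Sum>r<p - 1. 1 + (if r = q then 1 else 0))"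
    by (intro sum.cong) auto
  also have "\<dots> = p"
    using q by (subst sum.distrib) auto
  finally show ?thesis .
qed

lemma set_subst_word: "set (subst_word p q) \<subseteq> {..<p - 1}"
  by (auto simp: subst_word_def)

lemma set_Shat_word: "p \<ge> 3 \<Longrightarrow> set (Shat_word p l) \<subseteq> {..<p - 1}"
  using set_subst_word by (induction l) auto

lemma length_Shat_word: "p \<ge> 3 \<Longrightarrow> length (Shat_word p l) = p ^ Suc l"
proof (induction l)
  case (Suc l)
  have "map (length \<circ> subst_word p) (Shat_word p l) = map (\<lambda>_. p) (Shat_word p l)"
    using set_Shat_word[OF Suc.prems, of l] by (auto simp: length_subst_word)
  then have "length (Shat_word p (Suc l)) = length (Shat_word p l) * p"
    unfolding Shat_word.simps length_concat map_map by (simp only: sum_list_triv of_nat_id)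
  with Suc show ?case by simp
qed auto

lemma concat_map_duplicate:
  "q \<notin> set xs \<Longrightarrow> concat (map (\<lambda>s. if s = q then [s, s] else [s]) xs) = xs"
  by (induction xs) auto

lemma Shat_word_0_eq_subst_word:
  assumes "p \<ge> 3"
  shows "Shat_word p 0 = subst_word p (p - 2)"
proof -
  have "p - 1 = Suc (p - 2)" using assms by simp
  then have "rev [0..<p - 1] = (p - 2) # rev [0..<p - 2]" by simp
  then show ?thesis
    by (simp add: subst_word_def concat_map_duplicate)
qed

lemma Shat_word_step: "p \<ge> 3 \<Longrightarrow> \<exists>w. Shat_word p (Suc l) = Shat_word p l @ w"
proof (induction l)
  case 0
  have "Shat_word p (Suc 0) = subst_word p (p - 2) @ concat (map (subst_word p) (rev [0..<p - 1]))"
    by simp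
  then show ?case using Shat_word_0_eq_subst_word[OF 0] by metis
next
  case (Suc l)
  then obtain w where "Shat_word p (Suc l) = Shat_word p l @ w" by auto
  then have "concat (map (subst_word p) (Shat_word p (Suc l))) =
      concat (map (subst_word p) (Shat_word p l)) @ concat (map (subst_word p) w)"
    by (metis concat_append map_append)
  then show ?case by auto
qed

lemma Shat_word_mono:
  assumes "p \<ge> 3" "l \<le> l'"
  shows "\<exists>w. Shat_word p l' = Shat_word p l @ w"
  using assms(2)
proof (induction l' rule: dec_induct)
  case (step n)
  then show ?case using Shat_word_step[OF assms(1), of n] by (metis append.assoc)
qed auto

lemma Shat_prefix:
  assumes "p \<ge> 3"
  shows "map (Shat p) [0..<p ^ Suc l] = Shat_word p l"
proof (rule nth_equalityI)
  fix j assume "j < length (map (Shat p) [0..<p ^ Suc l])"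
  then have j: "j < p ^ Suc l" by simp
  have "j < p ^ Suc j"
  proof -
    have "j < 2 ^ j" by (rule less_exp)
    also have "(2::nat) ^ j \<le> p ^ j" using assms by (intro power_mono) auto
    also have "p ^ j \<le> p ^ Suc j" using assms by simp
    finally show ?thesis .
  qed
  then have "j < length (Shat_word p j)" "j < length (Shat_word p l)"
    using j by (simp_all only: length_Shat_word[OF assms])
  then have "Shat_word p j ! j = Shat_word p l ! j"
    using Shat_word_mono[OF assms, of j l] Shat_word_mono[OF assms, of l j]
    by (metis nat_le_linear nth_append)
  then show "map (Shat p) [0..<p ^ Suc l] ! j = Shat_word p l ! j"
    using j by (simp add: Shat_def del: power_Suc upt_Suc)
qed (simp add: length_Shat_word assms)

lemma space_Haar: "space (Haar p) = Zp p"
  by (auto simp: Haar_def Zp_def space_PiM space_uniform_count_measure PiE_def Pi_def)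

lemma prob_space_Haar: "p > 0 \<Longrightarrow> prob_space (Haar p)"
  unfolding Haar_def by (intro prob_space_PiM prob_space_uniform_count_measure) auto

lemma padd_in_Zp: "p > 0 \<Longrightarrow> padd p x y \<in> Zp p"
  by (auto simp: padd_def Zp_def)

lemma padic_succ_in_Zp: "p > 0 \<Longrightarrow> padic_succ p x \<in> Zp p"
  by (simp add: padic_succ_def padd_in_Zp)

lemma padic_succ_pow_in_Zp: "p > 0 \<Longrightarrow> x \<in> Zp p \<Longrightarrow> (padic_succ p ^^ i) x \<in> Zp p"
  by (cases i) (auto simp: padic_succ_in_Zp)

lemma measurable_coord: "(\<lambda>x. x k) \<in> measurable (Haar p) (count_space UNIV)"
proof -
  have "(\<lambda>x. x k) \<in> measurable (Haar p) (uniform_count_measure {..<p})"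
    unfolding Haar_def by (rule measurable_component_singleton) auto
  moreover have "(\<lambda>v. v) \<in> measurable (uniform_count_measure {..<p}) (count_space UNIV)"
    by (simp add: measurable_cong_sets[OF sets_uniform_count_measure_count_space refl])
  ultimately show ?thesis
    by (rule measurable_compose)
qed

lemma measurable_binop:
  fixes f g :: "'a \<Rightarrow> nat"
  assumes "f \<in> measurable M (count_space UNIV)" "g \<in> measurable M (count_space UNIV)"
  shows "(\<lambda>x. h (f x) (g x)) \<in> measurable M (count_space UNIV)"
proof (rule measurable_compose_countable[OF _ assms(1)])
  show "(\<lambda>x. h i (g x)) \<in> measurable M (count_space UNIV)" for i
    by (rule measurable_compose[OF assms(2)]) simp
qed

lemma measurable_carry: "(\<lambda>x. carry p x a k) \<in> measurable (Haar p) (count_space UNIV)"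
proof (induction k)
  case (Suc k)
  show ?case
    unfolding carry.simps
    by (rule measurable_binop[OF measurable_coord Suc, where h = "\<lambda>u v. (u + a k + v) div p"])
qed simp

lemma measurable_padd: 
  assumes "p > 0" shows "(\<lambda>x. padd p x a) \<in> measurable (Haar p) (Haar p)"
proof -
  have "(\<lambda>x. padd p x a k) \<in> measurable (Haar p) (uniform_count_measure {..<p})" for k
  proof -
    have "(\<lambda>x. padd p x a k) \<in> measurable (Haar p) (count_space UNIV)"
      unfolding padd_def
      by (rule measurable_binop[OF measurable_coord measurable_carry,
            where h = "\<lambda>u v. (u + a k + v) mod p"])
    then have "(\<lambda>x. padd p x a k) -` {v} \<inter> space (Haar p) \<in> sets (Haar p)" for v
      by (rule measurable_sets) simp
    moreover have "padd p x a k < p" for x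
      using assms by (simp add: padd_def)
    ultimately have "(\<lambda>x. padd p x a k) \<in> measurable (Haar p) (count_space {..<p})"
      by (subst measurable_count_space_eq2) auto
    then show ?thesis
      by (simp only: measurable_cong_sets[OF refl sets_uniform_count_measure_count_space])
  qed
  moreover have "(\<lambda>x. padd p x a) \<in> space (Haar p) \<rightarrow> space (Haar p)"
    using assms by (auto simp: space_Haar padd_in_Zp)
  then have "(\<lambda>x k. padd p x a k) \<in> space (Haar p) \<rightarrow> (\<Pi>\<^sub>E k\<in>UNIV. space (uniform_count_measure {..<p}))"
    by (simp add: Haar_def space_PiM)
  ultimately have "(\<lambda>x k. padd p x a k) \<in> measurable (Haar p) (PiM UNIV (\<lambda>_. uniform_count_measure {..<p}))"
    by (rule measurable_PiM_single')
  then show ?thesis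
    by (simp only: Haar_def)
qed

lemma measurable_phi: "phi p \<in> measurable (Haar p) (count_space UNIV)"
proof -
  note [measurable] = measurable_coord
  have "(\<lambda>x. LEAST k. x k \<noteq> p - 1) \<in> measurable (Haar p) (count_space UNIV)"
    by measurable
  then have "(\<lambda>x. x (LEAST k. x k \<noteq> p - 1)) \<in> measurable (Haar p) (count_space UNIV)"
    using measurable_coord by (rule measurable_compose_countable[rotated])
  then show ?thesis by (simp add: phi_def[abs_def])
qed

lemma measurable_padic_succ_pow: "p > 0 \<Longrightarrow> (padic_succ p ^^ i) \<in> measurable (Haar p) (Haar p)"
proof (induction i)
  case (Suc i)
  have "padic_succ p \<in> measurable (Haar p) (Haar p)"
    using measurable_padd[OF Suc.prems, of pone] by (simp add: padic_succ_def[abs_def])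
  then show ?case using measurable_comp[OF Suc.IH[OF Suc.prems]] by simp
qed (simp add: id_def)

lemma measurable_phi_sum:
  assumes "p > 0"
  shows "phi_sum p m \<in> measurable (Haar p) (count_space UNIV)"
proof -
  have [measurable]: "(\<lambda>x. phi p ((padic_succ p ^^ i) x)) \<in> measurable (Haar p) (count_space UNIV)" for i
    by (rule measurable_compose[OF measurable_padic_succ_pow[OF assms] measurable_phi])
  have "(\<lambda>x. \<Sum>i<m. phi p ((padic_succ p ^^ i) x)) \<in> measurable (Haar p) (count_space UNIV)"
  proof (induction m)
    case (Suc m)
    note [measurable] = Suc
    show ?case by simp
  qed simp
  then show ?thesis by (simp add: phi_sum_def[abs_def])
qed

lemma phi_sum_le:
  assumes "p > 0" "x \<in> Zp p"
  shows "phi_sum p m x \<le> m * (p - 1)"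
proof -
  have "phi p ((padic_succ p ^^ i) x) < p" for i
    using padic_succ_pow_in_Zp[OF assms, of i] by (simp add: Zp_def phi_def)
  then have "phi p ((padic_succ p ^^ i) x) \<le> p - 1" for i
    by (metis Suc_pred' assms(1) less_Suc_eq_le)
  then have "(\<Sum>i<m. phi p ((padic_succ p ^^ i) x)) \<le> (\<Sum>i<m. p - 1)"
    by (intro sum_mono) auto
  then show ?thesis by (simp add: phi_sum_def)
qed

lemma poly_Ppoly:
  assumes "p > 0"
  shows "poly (Ppoly p m) t = (LINT x|Haar p. t ^ phi_sum p m x)"
proof -
  interpret prob_space "Haar p" using assms by (rule prob_space_Haar)
  let ?J = "phi_sum p m ` Zp p"
  have fin: "finite ?J"
    using phi_sum_le[OF assms] by (intro finite_subset[of ?J "{..m * (p - 1)}"]) auto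
  have sets: "{x \<in> Zp p. phi_sum p m x = j} \<in> sets (Haar p)" for j
    using measurable_sets[OF measurable_phi_sum[OF assms, of m], of "{j}"]
    by (simp add: vimage_def space_Haar Int_def conj_commute)
  have "(LINT x|Haar p. t ^ phi_sum p m x) =
      (LINT x|Haar p. (\<Sum>j\<in>?J. indicator {x \<in> Zp p. phi_sum p m x = j} x * t ^ j))"
  proof (rule Bochner_Integration.integral_cong[OF refl])
    fix x assume "x \<in> space (Haar p)"
    then have x: "x \<in> Zp p" by (simp add: space_Haar)
    then have "(\<Sum>j\<in>?J. indicator {x \<in> Zp p. phi_sum p m x = j} x * t ^ j) =
        (\<Sum>j\<in>?J. if phi_sum p m x = j then t ^ j else 0)"
      by (intro sum.cong refl) (simp add: indicator_def)
    also have "\<dots> = t ^ phi_sum p m x"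
      using fin x by (subst sum.delta') auto
    finally show "t ^ phi_sum p m x =
        (\<Sum>j\<in>?J. indicator {x \<in> Zp p. phi_sum p m x = j} x * t ^ j)"
      by (rule sym)
  qed
  also have "\<dots> = (\<Sum>j\<in>?J. measure (Haar p) {x \<in> Zp p. phi_sum p m x = j} * t ^ j)"
    using sets by (subst Bochner_Integration.integral_sum) (auto simp: emeasure_eq_measure)
  also have "\<dots> = poly (Ppoly p m) t"
    by (simp add: Ppoly_def poly_sum poly_monom)
  finally show ?thesis by simp
qed

definition cyl :: "nat \<Rightarrow> nat \<Rightarrow> (nat \<Rightarrow> nat) \<Rightarrow> (nat \<Rightarrow> nat) set" where
  "cyl p n w = {x \<in> Zp p. \<forall>i<n. x i = w i}"

lemma emeasure_cyl:
  assumes "w \<in> Zp p"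
  shows "cyl p n w \<in> sets (Haar p)" "emeasure (Haar p) (cyl p n w) = ennreal ((1 / real p) ^ n)"
proof -
  have p: "p > 0" using assms by (auto simp: Zp_def)
  interpret product_prob_space "\<lambda>_. uniform_count_measure {..<p}" UNIV
    by (rule product_prob_spaceI) (use p in \<open>auto intro: prob_space_uniform_count_measure\<close>)
  have eq: "cyl p n w =
      prod_emb UNIV (\<lambda>_. uniform_count_measure {..<p}) {..<n} (PiE {..<n} (\<lambda>i. {w i}))"
    by (auto simp: cyl_def Zp_def prod_emb_def space_uniform_count_measure PiE_def Pi_def)
  show "cyl p n w \<in> sets (Haar p)"
    unfolding eq Haar_def using assms
    by (intro sets_PiM_I) (auto simp: sets_uniform_count_measure Zp_def)
  have "emeasure (Haar p) (cyl p n w) =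
      (\<Prod>i<n. emeasure (uniform_count_measure {..<p}) {w i})"
    unfolding eq Haar_def using assms
    by (intro emeasure_PiM_emb) (auto simp: sets_uniform_count_measure Zp_def)
  also have "\<dots> = (\<Prod>i<n. ennreal (1 / real p))"
    using assms by (intro prod.cong) (auto simp: emeasure_uniform_count_measure Zp_def)
  finally show "emeasure (Haar p) (cyl p n w) = ennreal ((1 / real p) ^ n)"
    by (simp add: ennreal_power)
qed

lemma carry_cong: "(\<And>i. i < k \<Longrightarrow> x i = y i) \<Longrightarrow> carry p x a k = carry p y a k"
  by (induction k) auto

lemma padd_cong: "(\<And>i. i < n \<Longrightarrow> x i = y i) \<Longrightarrow> i < n \<Longrightarrow> padd p x a i = padd p y a i"
  using carry_cong[of i x y p a] by (simp add: padd_def)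

lemma padd_inj:
  assumes "x \<in> Zp p" "y \<in> Zp p" "\<And>i. i < n \<Longrightarrow> padd p x a i = padd p y a i"
  shows "i < n \<Longrightarrow> x i = y i"
proof (induction i rule: less_induct)
  case (less i)
  then have c: "carry p x a i = carry p y a i"
    by (intro carry_cong) auto
  have "(x i + (a i + carry p y a i)) mod p = (y i + (a i + carry p y a i)) mod p"
    using assms(3)[OF less.prems] c by (simp add: padd_def add.assoc)
  then have "x i mod p = y i mod p"
    unfolding nat_mod_eq_iff by simp
  then show ?case using assms(1,2) by (simp add: Zp_def)
qed

lemma padd_surj:
  assumes "w \<in> Zp p" "a \<in> Zp p"
  shows "\<exists>z\<in>Zp p. \<forall>i<n. padd p z a i = w i"
proof (induction n)
  case 0
  then show ?case using assms by auto
next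
  case (Suc n)
  then obtain z where z: "z \<in> Zp p" "\<forall>i<n. padd p z a i = w i" by auto
  have p: "p > 0" using assms by (auto simp: Zp_def)
  define c where "c = a n + carry p z a n"
  define d where "d = (w n + (c * p - c)) mod p"
  define z' where "z' = z(n := d)"
  have 1: "padd p z' a i = w i" if "i < n" for i
    using z(2) that padd_cong[of n z' z i p a] by (auto simp: z'_def)
  have "padd p z' a n = (d + c) mod p"
    using carry_cong[of n z' z p a] by (simp add: padd_def z'_def c_def add.assoc)
  also have "\<dots> = (w n + (c * p - c) + c) mod p"
    by (simp add: d_def mod_simps)
  also have "\<dots> = (w n + c * p) mod p"
    using p by (cases p) (auto simp: algebra_simps)
  also have "\<dots> = w n"
    using assms by (simp add: Zp_def)
  finally have 2: "padd p z' a n = w n" .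
  have "z' \<in> Zp p" using z p by (auto simp: z'_def Zp_def d_def)
  with 1 2 show ?case by (metis less_Suc_eq)
qed

lemma sets_Haar_cyl:
  assumes "p > 0"
  shows "sets (Haar p) = sigma_sets (Zp p) (insert {} {cyl p n w | n w. w \<in> Zp p})" (is "_ = ?R")
proof
  interpret sigma_algebra "Zp p" ?R
    by (rule sigma_algebra_sigma_sets) (auto simp: cyl_def)
  have "{f \<in> Zp p. f i \<in> A} \<in> ?R" for i A
  proof -
    let ?C = "(\<lambda>w. cyl p (Suc i) w) ` {w \<in> Zp p. w i \<in> A}"
    have "?C \<subseteq> (\<lambda>w. {x \<in> Zp p. \<forall>j<Suc i. x j = w j}) ` (PiE {..<Suc i} (\<lambda>_. {..<p}))"
    proof
      fix B assume "B \<in> ?C"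
      then obtain w where w: "w \<in> Zp p" "B = cyl p (Suc i) w" by auto
      then have "B = {x \<in> Zp p. \<forall>j<Suc i. x j = restrict w {..<Suc i} j}"
        by (auto simp: cyl_def)
      moreover have "restrict w {..<Suc i} \<in> PiE {..<Suc i} (\<lambda>_. {..<p})"
        using w by (auto simp: Zp_def)
      ultimately show "B \<in> (\<lambda>w. {x \<in> Zp p. \<forall>j<Suc i. x j = w j}) ` (PiE {..<Suc i} (\<lambda>_. {..<p}))"
        by blast
    qed
    then have "finite ?C"
      by (rule finite_subset) (intro finite_imageI finite_PiE, auto)
    moreover have "?C \<subseteq> ?R" by auto
    ultimately have "\<Union>?C \<in> ?R" by (rule finite_Union)
    moreover have "{f \<in> Zp p. f i \<in> A} = \<Union>?C" by (auto simp: cyl_def)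
    ultimately show ?thesis by simp
  qed
  moreover have "sets (Haar p) = sigma_sets (Zp p)
      {{f \<in> Zp p. f i \<in> A} | i A. i \<in> UNIV \<and> A \<in> sets (uniform_count_measure {..<p})}"
    unfolding Haar_def sets_PiM_single space_Haar[of p, unfolded Haar_def space_PiM] by simp
  ultimately show "sets (Haar p) \<subseteq> ?R"
    by (auto intro!: sigma_sets_subset)
next
  show "?R \<subseteq> sets (Haar p)"
    using emeasure_cyl(1) unfolding space_Haar[symmetric]
    by (intro sets.sigma_sets_subset) (auto simp: space_Haar)
qed

theorem Haar_translation_invariant:
  assumes a: "a \<in> Zp p"
  shows "distr (Haar p) (Haar p) (\<lambda>x. padd p x a) = Haar p" (is "?D = _")
proof -
  have p: "p > 0" using a by (auto simp: Zp_def)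
  let ?E = "insert {} {cyl p n w | n w. w \<in> Zp p}"
  have "Int_stable ?E"
  proof (rule Int_stableI)
    fix A B assume AB: "A \<in> ?E" "B \<in> ?E"
    show "A \<inter> B \<in> ?E"
    proof (cases "A \<inter> B = {}")
      case False
      then obtain x where x: "x \<in> A" "x \<in> B" by auto
      with AB obtain n w n' w' where "A = cyl p n w" "B = cyl p n' w'" by auto
      with x have "A \<inter> B = cyl p (max n n') x" "x \<in> Zp p"
        by (auto simp: cyl_def less_max_iff_disj)
      then show ?thesis by blast
    qed simp
  qed
  then show ?thesis
  proof (rule measure_eqI_generator_eq[where \<Omega> = "Zp p" and A = "\<lambda>_. Zp p"])
    fix X assume "X \<in> ?E"
    then consider "X = {}" | n w where "X = cyl p n w" "w \<in> Zp p" by auto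
    then show "emeasure ?D X = emeasure (Haar p) X"
    proof cases
      case 2
      obtain z where z: "z \<in> Zp p" "\<And>i. i < n \<Longrightarrow> padd p z a i = w i"
        using padd_surj[OF 2(2) a, of n] by auto
      have "padd p x a \<in> cyl p n w \<longleftrightarrow> x \<in> cyl p n z" if "x \<in> Zp p" for x
        using that z padd_inj[OF that z(1), of n a] padd_cong[of n x z _ p a] padd_in_Zp[OF p]
        by (auto simp: cyl_def)
      then have "(\<lambda>x. padd p x a) -` X \<inter> space (Haar p) = cyl p n z"
        using 2 by (auto simp: space_Haar cyl_def)
      then show ?thesis
        using 2 z emeasure_cyl by (simp add: emeasure_distr measurable_padd[OF p])
    qed simp
  next
    show "range (\<lambda>_. Zp p) \<subseteq> ?E"
    proof -
      have "Zp p = cyl p 0 a" by (simp add: cyl_def)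
      then show ?thesis using a by blast
    qed
  next
    fix i :: nat
    interpret prob_space ?D
      by (intro prob_space.prob_space_distr prob_space_Haar p measurable_padd)
    show "emeasure ?D (Zp p) \<noteq> \<infinity>" by simp
  qed (use sets_Haar_cyl[OF p] in \<open>auto simp: cyl_def\<close>)
qed

end

theory Submission
  imports Defs
begin

text \<open>
  The leading digits \<open>(S\<^sup>i x)\<^sub>0\<close>, \<open>i < m\<close>, run cyclically through \<open>0, \<dots>, p - 1\<close>; those different from \<open>p - 1\<close>
  contribute themselves to \<open>\<phi>\<^sup>(\<^sup>m\<^sup>)\<close>, and those equal to \<open>p - 1\<close> contribute the value of \<open>\<phi>\<close> along the orbit
  of the shifted point. Write \<open>m = q p + r\<close> with \<open>r < p\<close>. The window contains \<open>q\<close> or \<open>q + 1\<close> digits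
  \<open>p - 1\<close>, and optimising over the first digit gives, for \<open>r > 0\<close>,
  \<open>D\<^sub>m = q (0 + \<dots> + (p - 2)) + D\<^sub>q + max (U r) (U (r - 1) + D\<^sub>q\<^sub>+\<^sub>1 - D\<^sub>q)\<close>, where \<open>U r\<close> is the sum of the
  \<open>r\<close> largest elements of \<open>{0, \<dots>, p - 2}\<close>. This maximum is the sum of the first \<open>r\<close> letters of the
  substitution word of \<open>s = D\<^sub>q\<^sub>+\<^sub>1 - D\<^sub>q\<close>, since that word lists \<open>0, \<dots>, p - 2\<close> and an extra \<open>s\<close> in
  decreasing order. So the degrees and the partial sums of the substitution sequence obey the same
  recursion.
\<close>

definition tri :: "nat \<Rightarrow> nat" where
  "tri n = \<Sum>{..<n}"

lemma tri_simps [simp]: "tri 0 = 0" "tri (Suc n) = tri n + n"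
  by (simp_all add: tri_def)

section \<open>The odometer and the cocycle under the shift\<close>

text \<open>In the group, \<open>x\<close> is \<open>x 0\<close> plus \<open>p\<close> times this
  point.\<close>

definition shift :: "(nat \<Rightarrow> nat) \<Rightarrow> (nat \<Rightarrow> nat)" where
  "shift x = (\<lambda>k. x (Suc k))"

lemma shift_in_Zp: "x \<in> Zp p \<Longrightarrow> shift x \<in> Zp p"
  by (simp add: Zp_def shift_def)

lemma padic_succ_0: "padic_succ p x 0 = Suc (x 0) mod p"
  by (simp add: padic_succ_def padd_def pone_def)

text \<open>The carry \<open>1\<close> out of the first digit acts as the summand \<open>1\<close>
  for the shifted point. There it is a digit and not a carry, which the term \<open>pone k\<close>
  corrects at \<open>k = 0\<close>.\<close>

lemma carry_pone_max_digit:
  assumes "p > 0" "x 0 = p - 1"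
  shows "carry p x pone (Suc k) = pone k + carry p (shift x) pone k"
  using assms by (induction k) (auto simp: pone_def shift_def)

lemma carry_pone_eq_0:
  assumes "x \<in> Zp p" "x 0 \<noteq> p - 1"
  shows "carry p x pone (Suc k) = 0"
proof (induction k)
  case 0
  have "x 0 < p" using assms by (simp add: Zp_def)
  with assms show ?case by (simp add: pone_def)
next
  case (Suc k)
  have "x (Suc k) < p" using assms by (simp add: Zp_def)
  with Suc show ?case by (simp add: pone_def)
qed

lemma shift_padic_succ:
  assumes "x \<in> Zp p"
  shows "shift (padic_succ p x) = (if x 0 = p - 1 then padic_succ p (shift x) else shift x)"
proof -
  have p: "p > 0" using assms by (auto simp: Zp_def)
  have "padic_succ p x (Suc k) = (if x 0 = p - 1 then padic_succ p (shift x) k else shift x k)" for k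
  proof (cases "x 0 = p - 1")
    case True
    have "padic_succ p x (Suc k) = (x (Suc k) + pone (Suc k) + carry p x pone (Suc k)) mod p"
      by (simp only: padic_succ_def padd_def)
    then show ?thesis unfolding carry_pone_max_digit[of p x, OF p True]
      using True by (simp add: padic_succ_def padd_def pone_def shift_def add.assoc)
  next
    case False
    have "padic_succ p x (Suc k) = (x (Suc k) + pone (Suc k) + carry p x pone (Suc k)) mod p"
      by (simp only: padic_succ_def padd_def)
    then show ?thesis unfolding carry_pone_eq_0[OF assms False]
      using False assms by (simp add: pone_def shift_def Zp_def)
  qed
  then show ?thesis by (auto simp: shift_def fun_eq_iff)
qed

lemma padic_succ_pow_0:
  assumes "x \<in> Zp p"
  shows "(padic_succ p ^^ i) x 0 = (x 0 + i) mod p"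
proof (induction i)
  case 0
  then show ?case using assms by (simp add: Zp_def)
next
  case (Suc i)
  then show ?case by (simp add: padic_succ_0 mod_Suc_eq)
qed

lemma shift_padic_succ_pow:
  assumes "x \<in> Zp p"
  shows "shift ((padic_succ p ^^ i) x) = (padic_succ p ^^ ((x 0 + i) div p)) (shift x)"
proof (induction i)
  case 0
  then show ?case using assms by (simp add: Zp_def)
next
  case (Suc i)
  have p: "p > 0" using assms by (auto simp: Zp_def)
  have "(x 0 + Suc i) div p =
      (if (x 0 + i) mod p = p - 1 then Suc ((x 0 + i) div p) else (x 0 + i) div p)"
    using p by (auto simp: div_Suc mod_Suc)
  moreover have "(padic_succ p ^^ i) x \<in> Zp p"
    using padic_succ_pow_in_Zp[OF p assms] .
  ultimately show ?case
    using Suc by (simp add: shift_padic_succ padic_succ_pow_0[OF assms])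
qed

lemma phi_shift: "phi p x = (if x 0 = p - 1 then phi p (shift x) else x 0)"
proof (cases "x 0 = p - 1")
  case True
  show ?thesis
  proof (cases "\<exists>k. x k \<noteq> p - 1")
    case ex: True
    then obtain k where "x k \<noteq> p - 1" by auto
    then have "(LEAST k. x k \<noteq> p - 1) = Suc (LEAST k. x (Suc k) \<noteq> p - 1)"
      by (rule Least_Suc) (simp add: True)
    with True show ?thesis by (simp add: phi_def shift_def)
  \<comment> \<open>At the constant sequence \<open>p - 1\<close> both sides are
    \<open>p - 1\<close>, whatever index \<open>LEAST\<close> returns.\<close>
  qed (use True in \<open>auto simp: phi_def shift_def\<close>)
next
  case False
  then have "(LEAST k. x k \<noteq> p - 1) = 0" by (intro Least_equality) auto
  with False show ?thesis by (simp add: phi_def)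
qed

lemma phi_padic_succ_pow:
  assumes "x \<in> Zp p"
  shows "phi p ((padic_succ p ^^ i) x) =
    (if (x 0 + i) mod p = p - 1 then phi p ((padic_succ p ^^ ((x 0 + i) div p)) (shift x))
     else (x 0 + i) mod p)"
  unfolding phi_shift[of p "(padic_succ p ^^ i) x"] padic_succ_pow_0[OF assms]
    shift_padic_succ_pow[OF assms] ..

lemma phi_sum_Suc: "phi_sum p (Suc m) x = phi_sum p m x + phi p ((padic_succ p ^^ m) x)"
  by (simp add: phi_sum_def)

text \<open>Each completed cycle of leading digits contributes \<open>tri (p - 1)\<close> and one
  value of \<open>phi\<close> along the orbit of \<open>shift x\<close>. Adding
  \<open>tri (x 0)\<close> extends the first cycle back to the digit \<open>0\<close>, which avoids
  subtraction.\<close>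

lemma phi_sum_shift:
  assumes "x \<in> Zp p"
  shows "phi_sum p m x + tri (x 0) =
    (x 0 + m) div p * tri (p - 1) + phi_sum p ((x 0 + m) div p) (shift x) + tri ((x 0 + m) mod p)"
proof (induction m)
  case 0
  then show ?case using assms by (simp add: Zp_def phi_sum_def)
next
  case (Suc m)
  have p: "p > 0" using assms by (auto simp: Zp_def)
  show ?case
  proof (cases "(x 0 + m) mod p = p - 1")
    case True
    then have "(x 0 + Suc m) div p = Suc ((x 0 + m) div p)" "(x 0 + Suc m) mod p = 0"
      using p by (auto simp: div_Suc mod_Suc)
    then show ?thesis
      using Suc True by (simp add: phi_sum_Suc phi_padic_succ_pow[OF assms])
  next
    case False
    then have "(x 0 + Suc m) div p = (x 0 + m) div p" "(x 0 + Suc m) mod p = Suc ((x 0 + m) mod p)"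
      using p by (auto simp: div_Suc mod_Suc)
    then show ?thesis
      using Suc False by (simp add: phi_sum_Suc phi_padic_succ_pow[OF assms])
  qed
qed

section \<open>Partial sums of the substitution sequence\<close>

lemma subst_word_eq:
  assumes "s < p - 1"
  shows "subst_word p s = rev [s..<p - 1] @ rev [0..<Suc s]"
proof -
  have "[0..<p - 1] = [0..<s] @ s # [Suc s..<p - 1]"
    using assms by (metis upt_add_eq_append upt_conv_Cons le_add_diff_inverse less_imp_le zero_le)
  then have "subst_word p s = rev [Suc s..<p - 1] @ [s, s] @ rev [0..<s]"
    by (simp add: subst_word_def concat_map_duplicate)
  moreover have "rev [s..<p - 1] = rev [Suc s..<p - 1] @ [s]"
    using assms by (simp add: upt_conv_Cons)
  ultimately show ?thesis by simp
qed

text \<open>From the second copy of \<open>s\<close>, at index \<open>p - 1 - s\<close>, the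
  decreasing list is delayed by one place.\<close>

lemma subst_word_nth:
  assumes "s < p - 1" "i < p"
  shows "subst_word p s ! i = (if i < p - 1 - s then p - 2 - i else p - 1 - i)"
  using assms unfolding subst_word_eq[OF assms(1)]
  by (auto simp: nth_append rev_nth simp del: upt_Suc)

lemma div_mod_block:
  fixes q b p :: nat
  assumes "n = q * p + b" "b < p"
  shows "n div p = q" "n mod p = b"
  using assms by auto

lemma concat_nth_uniform_length:
  assumes "\<And>xs. xs \<in> set xss \<Longrightarrow> length xs = p" "q < length xss" "r < p"
  shows "concat xss ! (q * p + r) = xss ! q ! r"
  using assms
proof (induction xss arbitrary: q)
  case (Cons xs xss)
  then have "length xs = p" by simp
  with Cons show ?case by (cases q) (auto simp: nth_append)
qed simp

context
  fixes p :: nat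
  assumes p3: "p \<ge> 3"
begin

lemma Shat_eq_Shat_word_nth: "j < p ^ Suc l \<Longrightarrow> Shat p j = Shat_word p l ! j"
  using Shat_prefix[OF p3, of l] by (metis length_upt minus_nat.diff_0 nth_map_upt add_0)

lemma less_power_Suc: "j < p ^ Suc j"
proof -
  have "j < 2 ^ j" by (rule less_exp)
  also have "(2::nat) ^ j \<le> p ^ j" using p3 by (intro power_mono) auto
  also have "p ^ j \<le> p ^ Suc j" using p3 by simp
  finally show ?thesis .
qed

lemma Shat_less: "Shat p j < p - 1"
proof -
  have "Shat p j \<in> set (Shat_word p j)"
    unfolding Shat_def using less_power_Suc length_Shat_word[OF p3] by (intro nth_mem) simp
  then show ?thesis using set_Shat_word[OF p3] by auto
qed

text \<open>The sequence is a fixed point of the substitution: the images of its letters are its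
  consecutive blocks of length \<open>p\<close>.\<close>

lemma Shat_recursion:
  assumes "r < p"
  shows "Shat p (q * p + r) = subst_word p (Shat p q) ! r"
proof -
  have q: "q < p ^ Suc q" by (rule less_power_Suc)
  then have "q * p + r < p ^ Suc (Suc q)"
  proof -
    have "q * p + r < Suc q * p" using assms by simp
    also have "\<dots> \<le> p ^ Suc q * p" using q by (intro mult_right_mono) auto
    finally show ?thesis by (simp add: mult.commute)
  qed
  then have "Shat p (q * p + r) = concat (map (subst_word p) (Shat_word p q)) ! (q * p + r)"
    by (simp add: Shat_eq_Shat_word_nth del: power_Suc)
  also have "\<dots> = map (subst_word p) (Shat_word p q) ! q ! r"
    using set_Shat_word[OF p3, of q] q assms
    by (intro concat_nth_uniform_length)
      (auto simp: length_Shat_word[OF p3] length_subst_word simp del: power_Suc)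
  also have "\<dots> = subst_word p (Shat p q) ! r"
    using q by (simp add: length_Shat_word[OF p3] Shat_def del: power_Suc)
  finally show ?thesis .
qed

text \<open>For \<open>r < p\<close> this is \<open>U r\<close>, the largest sum of \<open>r\<close>
  distinct elements of \<open>{..<p - 1}\<close>.\<close>

definition top_sum :: "nat \<Rightarrow> nat" where
  "top_sum r = (\<Sum>i<r. p - 2 - i)"

lemma top_sum_simps [simp]: "top_sum 0 = 0" "top_sum (Suc r) = top_sum r + (p - 2 - r)"
  by (simp_all add: top_sum_def)

lemma top_sum_pos: "r > 0 \<Longrightarrow> top_sum r = top_sum (r - 1) + (p - 1 - r)"
  by (cases r) auto

text \<open>Before the second copy of \<open>s\<close> a prefix lists the largest letters; a longer
  one consists of the extra \<open>s\<close> and the \<open>r - 1\<close> largest letters.\<close>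

lemma sum_subst_word:
  assumes "s < p - 1" "r \<le> p"
  shows "(\<Sum>i<r. subst_word p s ! i) = (if r \<le> p - 1 - s then top_sum r else s + top_sum (r - 1))"
  using assms(2)
proof (induction r)
  case (Suc r)
  have step: "(\<Sum>i<Suc r. subst_word p s ! i) = (\<Sum>i<r. subst_word p s ! i) + subst_word p s ! r"
    by simp
  consider "r < p - 1 - s" | "r = p - 1 - s" | "r > p - 1 - s" by linarith
  then show ?case
  proof cases
    case 3
    then have "top_sum r = top_sum (r - 1) + (p - 1 - r)"
      by (intro top_sum_pos) simp
    moreover have "subst_word p s ! r = p - 1 - r" "(\<Sum>i<r. subst_word p s ! i) = s + top_sum (r - 1)"
      using 3 Suc assms(1) by (simp_all add: subst_word_nth)
    moreover have "\<not> Suc r \<le> p - 1 - s" "Suc r - 1 = r" using 3 by simp_all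
    ultimately show ?thesis using step by (simp only: if_False)
  qed (use Suc assms(1) step in \<open>auto simp: subst_word_nth\<close>)
qed simp

text \<open>The closed forms are doubled and taken over the integers to avoid division and truncated
  subtraction.\<close>

lemma double_tri: "2 * int (tri n) = int n * (int n - 1)"
  by (induction n) (auto simp: algebra_simps)

lemma double_top_sum:
  "r \<le> p - 1 \<Longrightarrow> 2 * int (top_sum r) = int r * (2 * int p - 3 - int r)"
proof (induction r)
  case (Suc r)
  then have "int (p - 2 - r) = int p - 2 - int r" by simp
  with Suc show ?case by (simp add: algebra_simps)
qed simp

lemma top_sum_all: "top_sum (p - 1) = tri (p - 1)"
proof -
  have "2 * int (top_sum (p - 1)) = 2 * int (tri (p - 1))"
    unfolding double_tri double_top_sum[OF order_refl] using p3 by (simp add: of_nat_diff)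
  then show ?thesis by simp
qed

section \<open>Recursion for the partial sums over blocks of length \<open>p\<close>\<close>

definition Shat_sum :: "nat \<Rightarrow> nat" where
  "Shat_sum m = (\<Sum>j<m. Shat p j)"

lemma Shat_sum_Suc: "Shat_sum (Suc m) = Shat_sum m + Shat p m"
  by (simp add: Shat_sum_def)

text \<open>Block \<open>i\<close> lists \<open>0\<close> to \<open>p - 2\<close> once together with
  an extra \<open>Shat p i\<close>; the extras add up to \<open>Shat_sum q\<close>.\<close>

lemma Shat_sum_block: "Shat_sum (q * p) = q * tri (p - 1) + Shat_sum q"
proof (induction q)
  case (Suc q)
  have "Shat_sum (Suc q * p) = Shat_sum (q * p) + (\<Sum>r<p. Shat p (q * p + r))"
    unfolding Shat_sum_def using sum.nat_group[of "Shat p" p "Suc q"] sum.nat_group[of "Shat p" p q]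
    by (simp add: sum.shift_bounds_nat_ivl[of _ 0, simplified] lessThan_atLeast0 add.commute
        flip: sum.atLeastLessThan_shift_0)
  also have "(\<Sum>r<p. Shat p (q * p + r)) = tri (p - 1) + Shat p q"
  proof -
    have "(\<Sum>r<p. Shat p (q * p + r)) = (\<Sum>r<p. subst_word p (Shat p q) ! r)"
      by (intro sum.cong) (auto simp: Shat_recursion)
    moreover have "\<not> p \<le> p - 1 - Shat p q" using p3 by linarith
    ultimately show ?thesis
      using sum_subst_word[OF Shat_less order_refl, of q] top_sum_all by simp
  qed
  finally show ?case using Suc by (simp add: Shat_sum_def)
qed (simp add: Shat_sum_def)

lemma Shat_sum_recursion:
  assumes "r < p"
  shows "Shat_sum (q * p + r) =
    q * tri (p - 1) + Shat_sum q + (\<Sum>i<r. subst_word p (Shat p q) ! i)"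
proof -
  have "Shat_sum (q * p + n) = Shat_sum (q * p) + (\<Sum>i<n. Shat p (q * p + i))" for n
    by (induction n) (auto simp: Shat_sum_def)
  moreover have "(\<Sum>i<r. Shat p (q * p + i)) = (\<Sum>i<r. subst_word p (Shat p q) ! i)"
    using assms by (intro sum.cong) (auto simp: Shat_recursion)
  ultimately show ?thesis by (simp add: Shat_sum_block)
qed

lemma Shat_sum_ge_1:
  assumes "r < p"
  shows "q * tri (p - 1) + Shat_sum q + top_sum r \<le> Shat_sum (q * p + r)"
proof -
  have "top_sum r \<le> (\<Sum>i<r. subst_word p (Shat p q) ! i)"
    using assms Shat_less[of q] unfolding top_sum_def
    by (intro sum_mono) (auto simp: subst_word_nth)
  then show ?thesis by (simp add: Shat_sum_recursion[OF assms])
qed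

text \<open>If the prefix stops before the second copy of \<open>Shat p q\<close>, its last letter
  \<open>p - 1 - r\<close> is at least \<open>Shat p q\<close>; otherwise equality holds.\<close>

lemma Shat_sum_ge_2:
  assumes "r < p" "r > 0"
  shows "q * tri (p - 1) + Shat_sum (Suc q) + top_sum (r - 1) \<le> Shat_sum (q * p + r)"
proof -
  have "top_sum r = top_sum (r - 1) + (p - 1 - r)"
    using assms by (intro top_sum_pos)
  then have "Shat p q + top_sum (r - 1) \<le> (\<Sum>i<r. subst_word p (Shat p q) ! i)"
    using assms Shat_less[of q] by (auto simp: sum_subst_word)
  then show ?thesis by (simp add: Shat_sum_recursion[OF assms(1)] Shat_sum_Suc)
qed

text \<open>With the two preceding bounds this identifies the partial sum as the maximum of the two
  expressions, or as the first one if \<open>r = 0\<close>.\<close>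

lemma Shat_sum_cases:
  assumes "r < p"
  shows "Shat_sum (q * p + r) = q * tri (p - 1) + Shat_sum q + top_sum r \<or>
    r > 0 \<and> Shat_sum (q * p + r) = q * tri (p - 1) + Shat_sum (Suc q) + top_sum (r - 1)"
proof -
  show ?thesis
    unfolding Shat_sum_Suc Shat_sum_recursion[OF assms] sum_subst_word[OF Shat_less less_imp_le[OF assms]]
    by (cases "r \<le> p - 1 - Shat p q") auto
qed

lemma Shat_0: "Shat p 0 = p - 2"
  by (simp add: Shat_def)

section \<open>The maximum of the cocycle\<close>

text \<open>The digits \<open>a\<close> to \<open>a + r - 1\<close> are \<open>r\<close> consecutive
  numbers. Their sum falls short of \<open>top_sum r\<close> by \<open>r * (p - 1 - a - r)\<close>,
  which vanishes when the window ends at \<open>p - 2\<close>.\<close>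

lemma window_without_max_digit:
  assumes "a + r < p"
  shows "tri (a + r) \<le> tri a + top_sum r"
    and "a + r = p - 1 \<Longrightarrow> tri (a + r) = tri a + top_sum r"
proof -
  have U: "2 * int (top_sum r) = int r * (2 * int p - 3 - int r)"
    using assms by (intro double_top_sum) simp
  have *: "2 * int (tri a + top_sum r) - 2 * int (tri (a + r)) =
      2 * (int r * (int p - 1 - int a - int r))"
    unfolding of_nat_add distrib_left U double_tri by (simp add: algebra_simps)
  moreover have "int r * (int p - 1 - int a - int r) \<ge> 0"
    using assms by (intro mult_nonneg_nonneg) auto
  ultimately have "2 * int (tri (a + r)) \<le> 2 * int (tri a + top_sum r)"
    by (metis diff_ge_0_iff_ge mult_nonneg_nonneg zero_le_numeral)
  then show "tri (a + r) \<le> tri a + top_sum r"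
    by (simp del: of_nat_add)
  assume "a + r = p - 1"
  then have "int p - 1 - int a - int r = 0" using p3 by simp
  with * show "tri (a + r) = tri a + top_sum r" by simp
qed

text \<open>Apart from \<open>p - 1\<close> the window holds \<open>r - 1\<close> distinct digits.
  The deficit is \<open>(a + r - p) * (p - r)\<close>, which vanishes when the window ends at
  \<open>p - 1\<close>.\<close>

lemma window_with_max_digit:
  assumes "a < p" "r < p" "p \<le> a + r"
  shows "tri (p - 1) + tri (a + r - p) \<le> tri a + top_sum (r - 1)"
    and "a + r = p \<Longrightarrow> tri (p - 1) = tri a + top_sum (r - 1)"
proof -
  have r: "r > 0" using assms by simp
  have U: "2 * int (top_sum (r - 1)) = (int r - 1) * (2 * int p - 2 - int r)"
    using double_top_sum[of "r - 1"] assms r by (simp add: of_nat_diff)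
  have *: "2 * int (tri a + top_sum (r - 1)) - 2 * int (tri (p - 1) + tri (a + r - p)) =
      2 * ((int a + int r - int p) * (int p - int r))"
    unfolding of_nat_add distrib_left U double_tri
    using assms p3 by (simp add: of_nat_diff algebra_simps)
  moreover have "(int a + int r - int p) * (int p - int r) \<ge> 0"
    using assms by (intro mult_nonneg_nonneg) auto
  ultimately have "2 * int (tri (p - 1) + tri (a + r - p)) \<le> 2 * int (tri a + top_sum (r - 1))"
    by (metis diff_ge_0_iff_ge mult_nonneg_nonneg zero_le_numeral)
  then show "tri (p - 1) + tri (a + r - p) \<le> tri a + top_sum (r - 1)"
    by (simp del: of_nat_add)
  assume ar: "a + r = p"
  then have "int a + int r - int p = 0" by simp
  with * ar show "tri (p - 1) = tri a + top_sum (r - 1)" by simp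
qed

text \<open>Excludes the orbits that meet the constant sequence \<open>p - 1\<close> before time
  \<open>m\<close>: the conventional value \<open>p - 1\<close> of \<open>phi\<close> there violates
  the upper bound already for \<open>m = 1\<close>.\<close>

definition regular :: "nat \<Rightarrow> (nat \<Rightarrow> nat) \<Rightarrow> bool" where
  "regular m x \<longleftrightarrow> x \<in> Zp p \<and> (\<forall>i<m. \<exists>k. (padic_succ p ^^ i) x k \<noteq> p - 1)"

lemma regular_shift:
  assumes "regular m x"
  shows "regular ((x 0 + m) div p) (shift x)"
  unfolding regular_def
proof (intro conjI allI impI)
  have x: "x \<in> Zp p" and xp: "x 0 < p" using assms by (auto simp: regular_def Zp_def)
  show "shift x \<in> Zp p" using x by (rule shift_in_Zp)
  fix i assume "i < (x 0 + m) div p"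
  then have "Suc i * p \<le> x 0 + m"
    using p3 by (metis Suc_leI div_times_less_eq_dividend mult_le_mono1 order_trans)
  \<comment> \<open>At time \<open>n\<close> the leading digit is \<open>p - 1\<close> and the tail
    is orbit point \<open>i\<close> of \<open>shift x\<close>, so a digit other than
    \<open>p - 1\<close> must lie in that tail.\<close>
  moreover define n where "n = i * p + (p - 1) - x 0"
  moreover have n: "x 0 + n = i * p + (p - 1)" using xp by (simp add: n_def)
  ultimately have "n < m" using p3 by simp
  then obtain k where k: "(padic_succ p ^^ n) x k \<noteq> p - 1" using assms by (auto simp: regular_def)
  have "(x 0 + n) mod p = p - 1" "(x 0 + n) div p = i"
    using div_mod_block[OF n] p3 by simp_all
  then have 0: "(padic_succ p ^^ n) x 0 = p - 1"
    and s: "shift ((padic_succ p ^^ n) x) = (padic_succ p ^^ i) (shift x)"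
    using padic_succ_pow_0[OF x, of n] shift_padic_succ_pow[OF x, of n] by simp_all
  from k 0 obtain k' where "k = Suc k'" by (cases k) auto
  with k have "shift ((padic_succ p ^^ n) x) k' \<noteq> p - 1" by (simp add: shift_def)
  then show "\<exists>k. (padic_succ p ^^ i) (shift x) k \<noteq> p - 1" using s by metis
qed

text \<open>Allows maximisers to be built by prepending a digit. A leading digit other than
  \<open>p - 1\<close> is itself a witness; otherwise the orbit of \<open>y\<close> supplies
  one.\<close>

lemma regular_case_nat:
  assumes "regular ((a + m) div p) y" "a < p"
  shows "regular m (case_nat a y)"
proof -
  let ?x = "case_nat a y"
  have y: "y \<in> Zp p" using assms by (simp add: regular_def)
  then have x: "?x \<in> Zp p" using assms(2) by (auto simp: Zp_def split: nat.split)
  have sh: "shift ?x = y" by (simp add: shift_def)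
  have "\<exists>k. (padic_succ p ^^ i) ?x k \<noteq> p - 1" if "i < m" for i
  proof (cases "(a + i) mod p = p - 1")
    case False
    then show ?thesis using padic_succ_pow_0[OF x, of i] by (intro exI[of _ 0]) simp
  next
    case True
    have "Suc ((a + i) div p) = Suc (a + i) div p"
      using True p3 by (simp add: div_Suc mod_Suc)
    also have "\<dots> \<le> (a + m) div p" using that by (intro div_le_mono) simp
    finally obtain k where "(padic_succ p ^^ ((a + i) div p)) y k \<noteq> p - 1"
      using assms(1) by (auto simp: regular_def Suc_le_eq)
    then have "(padic_succ p ^^ i) ?x (Suc k) \<noteq> p - 1"
      using shift_padic_succ_pow[OF x, of i] sh by (simp add: shift_def fun_eq_iff)
    then show ?thesis by blast
  qed
  with x show ?thesis by (simp add: regular_def)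
qed

lemma phi_sum_le_Shat_sum: "regular m x \<Longrightarrow> phi_sum p m x \<le> Shat_sum m"
proof (induction m arbitrary: x rule: less_induct)
  case (less m)
  have x: "x \<in> Zp p" and xp: "x 0 < p" using less.prems by (auto simp: regular_def Zp_def)
  define q r where "q = m div p" and "r = m mod p"
  have m: "m = q * p + r" and r: "r < p" using p3 by (auto simp: q_def r_def)
  consider "m = 0" | "m = 1" | "m \<ge> 2" by linarith
  then show ?case
  proof cases
    \<comment> \<open>For \<open>m = 1\<close> and \<open>x 0 = p - 1\<close> the shifted sum again
      has length \<open>1\<close>, so the induction hypothesis does not apply.\<close>
    case 2
    then obtain k where "x k \<noteq> p - 1" using less.prems by (auto simp: regular_def)
    then have "phi p x \<noteq> p - 1" unfolding phi_def by (rule LeastI)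
    moreover have "phi p x < p" using x by (simp add: phi_def Zp_def)
    ultimately show ?thesis using 2 Shat_0 by (simp add: phi_sum_def Shat_sum_def)
  next
    case 3
    have "Suc q < m"
    proof (cases q)
      case (Suc n)
      have "q * 3 \<le> q * p" using p3 by (intro mult_left_mono) auto
      with Suc m show ?thesis by linarith
    qed (use 3 in simp)
    note IH = less.IH[OF _ regular_shift[OF less.prems]]
    note eq = phi_sum_shift[OF x, of m]
    show ?thesis
    proof (cases "x 0 + r < p")
      case True
      have "x 0 + m = q * p + (x 0 + r)" using m by simp
      note d = div_mod_block[OF this True]
      have "phi_sum p q (shift x) \<le> Shat_sum q"
        using IH \<open>Suc q < m\<close> by (simp add: d)
      with eq window_without_max_digit(1)[OF True] Shat_sum_ge_1[OF r, of q]
      show ?thesis unfolding d m[symmetric] by linarith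
    next
      case False
      have "x 0 + m = Suc q * p + (x 0 + r - p)" using m False by simp
      moreover have "x 0 + r - p < p" using xp r by simp
      ultimately have d: "(x 0 + m) div p = Suc q" "(x 0 + m) mod p = x 0 + r - p"
        by (rule div_mod_block)+
      have "phi_sum p (Suc q) (shift x) \<le> Shat_sum (Suc q)"
        using IH \<open>Suc q < m\<close> by (simp add: d)
      moreover have "r > 0" using False xp by simp
      ultimately show ?thesis
        using eq window_with_max_digit(1)[OF xp r] Shat_sum_ge_2[OF r, of q] False
        unfolding d m[symmetric] by simp
    qed
  qed (simp add: phi_sum_def)
qed

lemma phi_sum_attains_Shat_sum: "\<exists>x. regular m x \<and> phi_sum p m x = Shat_sum m"
proof (induction m rule: less_induct)
  case (less m)
  define q r where "q = m div p" and "r = m mod p"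
  have m: "m = q * p + r" and r: "r < p" using p3 by (auto simp: q_def r_def)
  have step: "\<exists>x. regular m x \<and> phi_sum p m x + tri a =
      (a + m) div p * tri (p - 1) + Shat_sum ((a + m) div p) + tri ((a + m) mod p)"
    if a: "a < p" and lt: "(a + m) div p < m" for a
  proof -
    obtain y where y: "regular ((a + m) div p) y" "phi_sum p ((a + m) div p) y = Shat_sum ((a + m) div p)"
      using less.IH[OF lt] by auto
    have reg: "regular m (case_nat a y)" using y(1) a by (rule regular_case_nat)
    moreover have "shift (case_nat a y) = y" by (simp add: shift_def)
    ultimately show ?thesis
      using phi_sum_shift[of "case_nat a y" p m] y(2) by (auto simp: regular_def)
  qed
  show ?case
  proof (cases "m = 0")
    case True
    have "(\<lambda>_. 0) \<in> Zp p" using p3 by (simp add: Zp_def)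
    with True show ?thesis by (auto simp: regular_def phi_sum_def Shat_sum_def)
  next
    case False
    have "q * 3 \<le> q * p" using p3 by (intro mult_left_mono) auto
    with m False have "q < m" by linarith
    have first: ?thesis
      if eq: "Shat_sum m = q * tri (p - 1) + Shat_sum q + top_sum r"
    proof -
      \<comment> \<open>With this first digit the final partial cycle ends at \<open>p - 2\<close>,
        the equality case without an additional digit \<open>p - 1\<close>.\<close>
      define a where "a = p - 1 - r"
      have a: "a + r = p - 1" "a < p" using r p3 by (auto simp: a_def)
      then have "a + m = q * p + (p - 1)" using m by simp
      then have d: "(a + m) div p = q" "(a + m) mod p = p - 1"
        using div_mod_block[of "a + m" q p "p - 1"] p3 by simp_all
      have "tri (p - 1) = tri a + top_sum r"
        using window_without_max_digit(2)[of a r] a p3 by simp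
      then show ?thesis using step[OF a(2)] \<open>q < m\<close> eq unfolding d by auto
    qed
    show ?thesis
    proof (cases "m = 1")
      case True
      \<comment> \<open>Here \<open>Suc q = m\<close>, so only the first alternative allows the
        induction; it holds because \<open>Shat p 0 = p - 2\<close>.\<close>
      then have "q = 0" "r = 1" using p3 by (auto simp: q_def r_def)
      with True show ?thesis by (intro first) (simp add: Shat_sum_def Shat_0)
    next
      case False
      with \<open>q < m\<close> \<open>q * 3 \<le> q * p\<close> m have "Suc q < m" by linarith
      from Shat_sum_cases[OF r, of q, folded m] show ?thesis
      proof (elim disjE conjE)
        assume "r > 0" and eq: "Shat_sum m =
          q * tri (p - 1) + Shat_sum (Suc q) + top_sum (r - 1)"
        \<comment> \<open>Now the window ends exactly at a digit \<open>p - 1\<close>, the other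
          equality case.\<close>
        define a where "a = p - r"
        have a: "a + r = p" "a < p" using r \<open>r > 0\<close> by (auto simp: a_def)
        then have "a + m = Suc q * p" using m by simp
        then have d: "(a + m) div p = Suc q" "(a + m) mod p = 0" using p3 by auto
        have "tri (p - 1) = tri a + top_sum (r - 1)"
          using window_with_max_digit(2)[of a r] a r by simp
        then show ?thesis using step[OF a(2)] \<open>Suc q < m\<close> eq unfolding d by auto
      qed (rule first)
    qed
  qed
qed

section \<open>Null sets and cylinders\<close>

text \<open>The odometer is injective, so the constant sequence \<open>p - 1\<close> has at most one
  preimage under each of the first \<open>m\<close> iterates.\<close>

lemma finite_not_regular: "finite {x \<in> Zp p. \<not> regular m x}"
proof -
  have inj: "inj_on (padic_succ p) (Zp p)"
  proof (rule inj_onI)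
    fix x y assume "x \<in> Zp p" "y \<in> Zp p" "padic_succ p x = padic_succ p y"
    then show "x = y"
      using padd_inj[of x p y _ pone] by (intro ext) (metis lessI padic_succ_def)
  qed
  have "inj_on (padic_succ p ^^ i) (Zp p)" for i
  proof (induction i)
    case (Suc i)
    have "(padic_succ p ^^ i) ` Zp p \<subseteq> Zp p"
      using padic_succ_pow_in_Zp[of p _ i] p3 by auto
    then show ?case
      using comp_inj_on[OF Suc inj_on_subset[OF inj]] by (simp add: comp_def)
  qed simp
  then have "finite ((padic_succ p ^^ i) -` {\<lambda>_. p - 1} \<inter> Zp p)" for i
    by (intro finite_vimage_IntI) auto
  then have "finite (\<Union>i<m. (padic_succ p ^^ i) -` {\<lambda>_. p - 1} \<inter> Zp p)" by blast
  then show ?thesis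
    by (rule rev_finite_subset) (auto simp: regular_def)
qed

lemma measure_cyl: "x \<in> Zp p \<Longrightarrow> measure (Haar p) (cyl p n x) = (1 / real p) ^ n"
  by (simp add: measure_def emeasure_cyl(2))

lemma null_sets_singleton: "x \<in> Zp p \<Longrightarrow> {x} \<in> null_sets (Haar p)"
proof -
  assume x: "x \<in> Zp p"
  interpret prob_space "Haar p" using p3 by (intro prob_space_Haar) simp
  have "{x} = (\<Inter>n. cyl p n x)" using x by (auto simp: cyl_def)
  moreover have "(\<Inter>n. cyl p n x) \<in> sets (Haar p)"
    using emeasure_cyl(1)[OF x] by (intro sets.countable_INT) auto
  ultimately have sets: "{x} \<in> sets (Haar p)" by simp
  have "measure (Haar p) {x} \<le> (1 / real p) ^ n" for n
  proof -
    have "measure (Haar p) {x} \<le> measure (Haar p) (cyl p n x)"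
      using x by (intro finite_measure_mono emeasure_cyl(1)) (simp_all add: cyl_def)
    then show ?thesis by (simp only: measure_cyl[OF x])
  qed
  moreover have "(\<lambda>n. (1 / real p) ^ n) \<longlonglongrightarrow> 0"
    using p3 by (intro LIMSEQ_realpow_zero) auto
  ultimately have "measure (Haar p) {x} \<le> 0"
    by (intro LIMSEQ_le_const[of "\<lambda>n. (1 / real p) ^ n"]) auto
  then have "measure (Haar p) {x} = 0"
    by (intro antisym measure_nonneg)
  then show ?thesis
    using sets by (intro null_setsI) (simp_all only: emeasure_eq_measure ennreal_0)
qed

section \<open>Local constancy of the cocycle\<close>

lemma padic_succ_pow_cong:
  assumes "\<And>i. i < n \<Longrightarrow> x i = y i" "i < n"
  shows "(padic_succ p ^^ j) x i = (padic_succ p ^^ j) y i"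
  using assms(2)
proof (induction j arbitrary: i)
  case (Suc j)
  show ?case using padd_cong[OF Suc.IH Suc.prems] by (simp add: padic_succ_def)
qed (simp add: assms(1))

lemma phi_cong:
  assumes "\<And>i. i \<le> k \<Longrightarrow> x i = y i" "y k \<noteq> p - 1"
  shows "phi p x = phi p y"
proof -
  define l where "l = (LEAST k. y k \<noteq> p - 1)"
  have l: "y l \<noteq> p - 1" "l \<le> k"
    using assms(2) unfolding l_def by (rule LeastI, rule Least_le)
  have "(LEAST k. x k \<noteq> p - 1) = l"
  proof (rule Least_equality)
    show "x l \<noteq> p - 1" using l assms(1) by simp
    fix i assume i: "x i \<noteq> p - 1"
    show "l \<le> i"
    proof (rule ccontr)
      assume "\<not> l \<le> i"
      then have "y i \<noteq> p - 1" "i < l" using i assms(1) l by auto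
      then show False unfolding l_def by (metis not_less_Least)
    qed
  qed
  then show ?thesis using l assms(1) by (simp add: phi_def l_def)
qed

text \<open>At a regular point every summand is decided by finitely many digits, and the first
  \<open>n\<close> digits of all orbit points depend only on those of \<open>x\<close>.\<close>

lemma phi_sum_locally_constant:
  assumes "regular m x"
  shows "\<exists>n. \<forall>y\<in>cyl p n x. phi_sum p m y = phi_sum p m x"
proof -
  obtain k where k: "\<And>i. i < m \<Longrightarrow> (padic_succ p ^^ i) x (k i) \<noteq> p - 1"
    using assms unfolding regular_def by metis
  define n where "n = Suc (\<Sum>i<m. k i)"
  have "k i < n" if "i < m" for i
    using that by (simp add: n_def less_Suc_eq_le member_le_sum)
  then have "phi p ((padic_succ p ^^ i) y) = phi p ((padic_succ p ^^ i) x)"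
    if "y \<in> cyl p n x" "i < m" for y i
    using that k by (intro phi_cong[of "k i"] padic_succ_pow_cong[of n])
      (auto simp: cyl_def intro: le_less_trans)
  then show ?thesis by (auto simp: phi_sum_def intro!: exI[of _ n] sum.cong)
qed

lemma phi_sum_level_in_sets: "{x \<in> Zp p. phi_sum p m x = j} \<in> sets (Haar p)"
proof -
  have "phi_sum p m -` {j} \<inter> space (Haar p) \<in> sets (Haar p)"
    using p3 by (intro measurable_sets[OF measurable_phi_sum]) auto
  then show ?thesis by (simp add: space_Haar vimage_def Int_def conj_commute)
qed

section \<open>Coefficients and degree\<close>

lemma coeff_Ppoly: "coeff (Ppoly p m) j = measure (Haar p) {x \<in> Zp p. phi_sum p m x = j}"
proof -
  let ?J = "phi_sum p m ` Zp p"
  have "finite ?J"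
    using phi_sum_le[of p _ m] p3 by (intro finite_subset[of ?J "{..m * (p - 1)}"]) auto
  then have "coeff (Ppoly p m) j =
      (if j \<in> ?J then measure (Haar p) {x \<in> Zp p. phi_sum p m x = j} else 0)"
    by (simp add: Ppoly_def coeff_sum)
  also have "\<dots> = measure (Haar p) {x \<in> Zp p. phi_sum p m x = j}"
  proof (cases "j \<in> ?J")
    case False
    then have "{x \<in> Zp p. phi_sum p m x = j} = {}" by auto
    with False show ?thesis by (simp only: if_False measure_empty)
  qed simp
  finally show ?thesis .
qed

text \<open>Level sets above \<open>Shat_sum m\<close> consist of finitely many irregular points and
  are null. The level \<open>Shat_sum m\<close> contains a cylinder, so its coefficient is
  positive.\<close>

lemma degree_Ppoly: "degree (Ppoly p m) = Shat_sum m"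
proof (rule antisym)
  interpret prob_space "Haar p" using p3 by (intro prob_space_Haar) simp
  show "degree (Ppoly p m) \<le> Shat_sum m"
  proof (rule degree_le, intro allI impI)
    fix j assume "Shat_sum m < j"
    then have "{x \<in> Zp p. phi_sum p m x = j} \<subseteq> (\<Union>x\<in>{x \<in> Zp p. \<not> regular m x}. {x})"
      using phi_sum_le_Shat_sum by fastforce
    moreover have "(\<Union>x\<in>{x \<in> Zp p. \<not> regular m x}. {x}) \<in> null_sets (Haar p)"
      using finite_not_regular by (intro null_sets_UN' null_sets_singleton)
        (auto intro: countable_finite)
    ultimately have "{x \<in> Zp p. phi_sum p m x = j} \<in> null_sets (Haar p)"
      by (rule null_sets_subset[rotated 2]) (rule phi_sum_level_in_sets)
    then show "coeff (Ppoly p m) j = 0"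
      by (simp add: coeff_Ppoly measure_eq_0_null_sets)
  qed
  obtain x where x: "regular m x" "phi_sum p m x = Shat_sum m"
    using phi_sum_attains_Shat_sum by blast
  then obtain n where n: "\<forall>y\<in>cyl p n x. phi_sum p m y = Shat_sum m"
    using phi_sum_locally_constant by metis
  have xZ: "x \<in> Zp p" using x by (simp add: regular_def)
  have "0 < (1 / real p) ^ n" using p3 by simp
  also have "\<dots> = measure (Haar p) (cyl p n x)"
    by (simp only: measure_cyl[OF xZ])
  also have "\<dots> \<le> measure (Haar p) {x \<in> Zp p. phi_sum p m x = Shat_sum m}"
    using n by (intro finite_measure_mono phi_sum_level_in_sets) (auto simp: cyl_def)
  finally show "Shat_sum m \<le> degree (Ppoly p m)"
    by (intro le_degree) (simp add: coeff_Ppoly)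
qed

end

theorem corollary5p1:
  fixes p m :: nat
  assumes "p \<ge> 3"
  shows "degree (Ppoly p m) = (\<Sum>j<m. Shat p j)"
  using degree_Ppoly[OF assms] by (simp add: Shat_sum_def[OF assms])

end
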